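(* Let $1\le m\le n$, and let $a_1,a_2,\ldots,a_{n+1}\in\mathbb{R}^n$ be the vertices of a non-degenerate simplex $\Sigma$ in $\mathbb{R}^n$ whose centre of mass is at the origin (i.e. $a_1+\cdots+a_{n+1}=0$). Let $A$ be the $n\times(n+1)$ matrix with columns $a_1,\ldots,a_{n+1}$ and let $$Q=A^t(AA^t)^{-2}A .$$ Given $b_1,b_2,\ldots,b_{n+1}\in\mathbb{R}^m$, assembled as the columns of an $m\times(n+1)$ matrix $B$, these vectors are the images under the orthogonal projection $P:\mathbb{R}^n\to\mathbb{R}^m$ of the vertices of a simplex congruent to $\Sigma$ if and only if $$BQB^t=1,$$ where $1$ denotes the $m\times m$ identity matrix.
   Context: $P:\mathbb{R}^n\to\mathbb{R}^m$ is the standard projection onto the first $m$ coordinates. The superscript $t$ denotes transpose. Since $\Sigma$ is non-degenerate, $A$ has rank $n$ and so $AA^t$ is invertible. A simplex congruent to $\Sigma$ is one whose (correspondingly ordered) vertices are $Ua_1+a,\ldots,Ua_{n+1}+a$ for some orthogonal $n\times n$ matrix $U$ and some translation vector $a\in\mathbb{R}^n$. That $b_1,\ldots,b_{n+1}$ are the images of the vertices means that $b_j=P(Ua_j+a)$ for $j=1,\ldots,n+1$, for some such $U$ and $a$. *)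

theory Defs
  imports "Jordan_Normal_Form.Matrix" "Jordan_Normal_Form.Gauss_Jordan_Elimination"
begin

text \<open>
  Vectors of \<open>\<real>\<^sup>n\<close> are elements of \<^term>\<open>carrier_vec n :: real vec set\<close>. The \<open>n + 1\<close> vertices
  \<open>a\<^sub>1, \<dots>, a\<^sub>n\<^sub>+\<^sub>1\<close> are indexed from 0, as \<open>a 0, \<dots>, a n\<close>; the values of \<open>a\<close> at larger indices
  are irrelevant.
\<close>

text \<open>
  Non-degeneracy is affine independence of the vertices as an indexed family, so it also excludes
  repeated vertices.
\<close>

definition nondegenerate_simplex :: "nat \<Rightarrow> (nat \<Rightarrow> real vec) \<Rightarrow> bool" where
  "nondegenerate_simplex n a \<longleftrightarrow>
     (\<forall>j\<le>n. a j \<in> carrier_vec n) \<and>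
     (\<forall>c. (\<Sum>j\<le>n. c j) = 0 \<and> finsum_vec TYPE(real) n (\<lambda>j. c j \<cdot>\<^sub>v a j) {..n} = 0\<^sub>v n
        \<longrightarrow> (\<forall>j\<le>n. c j = 0))"

text \<open>
  The library's \<^const>\<open>orthogonal_mat\<close> only asks for pairwise orthogonal nonzero columns, without
  normalisation, hence the following definition.
\<close>

definition real_orthogonal_mat :: "nat \<Rightarrow> real mat \<Rightarrow> bool" where
  "real_orthogonal_mat n U \<longleftrightarrow>
     U \<in> carrier_mat n n \<and> U\<^sup>T * U = 1\<^sub>m n \<and> U * U\<^sup>T = 1\<^sub>m n"

definition congruent_simplices :: "nat \<Rightarrow> (nat \<Rightarrow> real vec) \<Rightarrow> (nat \<Rightarrow> real vec) \<Rightarrow> bool" where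
  "congruent_simplices n a c \<longleftrightarrow>
     (\<exists>U t. real_orthogonal_mat n U \<and> t \<in> carrier_vec n \<and> (\<forall>j\<le>n. c j = U *\<^sub>v a j + t))"

definition columns_mat :: "nat \<Rightarrow> nat \<Rightarrow> (nat \<Rightarrow> real vec) \<Rightarrow> real mat" where
  "columns_mat d n a = mat_of_cols d (map a [0..<n + 1])"

text \<open>
  \<^const>\<open>mat_inverse\<close> returns \<^const>\<open>None\<close> exactly on non-invertible matrices; \<open>A A\<^sup>t\<close> is
  invertible whenever the columns of \<open>A\<close> are the vertices of a non-degenerate simplex.
\<close>

definition Q_mat :: "real mat \<Rightarrow> real mat" where
  "Q_mat A = A\<^sup>T * (the (mat_inverse (A * A\<^sup>T)) ^\<^sub>m 2) * A"

end

theory Submission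
  imports Defs "Jordan_Normal_Form.Determinant"
begin

text \<open>
  Projecting the congruent simplex with vertices \<open>U a\<^sub>j + t\<close> to the first \<open>m\<close> coordinates gives the
  points \<open>V a\<^sub>j + s\<close>, where \<open>V\<close> consists of the first \<open>m\<close> rows of \<open>U\<close> and \<open>s\<close> of the first \<open>m\<close>
  entries of \<open>t\<close>. Conversely, orthonormal rows extend to an orthogonal matrix. So
  (\<open>projection_of_congruent_iff\<close>) the question is for which \<open>B\<close> there are \<open>V\<close> with
  \<open>V V\<^sup>T = 1\<close> and a vector \<open>s\<close> such that \<open>b\<^sub>j = V a\<^sub>j + s\<close> for all \<open>j\<close>.

  This \<open>V\<close> can only be the least-squares solution \<open>V = B A\<^sup>T (A A\<^sup>T)\<^sup>-\<^sup>1\<close>: multiplying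
  \<open>B = V A + (s, \<dots>, s)\<close> by \<open>A\<^sup>T\<close> on the right removes the translation because the columns of
  \<open>A\<close> sum to zero. In the other direction this \<open>V\<close> always fits \<open>B\<close> up to a translation:
  the columns of \<open>R = 1 - A\<^sup>T (A A\<^sup>T)\<^sup>-\<^sup>1 A\<close> are linear relations between the vertices, and for
  a centred non-degenerate simplex such relations have equal coefficients
  (\<open>centred_simplex_relation_constant\<close>); as \<open>R\<close> is symmetric, all its entries are equal, and hence
  the columns of \<open>B - V A = B R\<close> coincide. The only condition left is \<open>V V\<^sup>T = 1\<close>, and for this
  \<open>V\<close> the product \<open>V V\<^sup>T = B A\<^sup>T (A A\<^sup>T)\<^sup>-\<^sup>2 A B\<^sup>T\<close> is \<open>B Q B\<^sup>T\<close>.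
\<close>

section \<open>Extending orthonormal rows\<close>

lemma real_scalar_prod_self_eq_0:
  fixes v :: "real vec"
  assumes v: "v \<in> carrier_vec n" and "v \<bullet> v = 0"
  shows "v = 0\<^sub>v n"
proof (rule eq_vecI)
  fix i assume i: "i < dim_vec (0\<^sub>v n :: real vec)"
  have "(\<Sum>i\<in>{0..<n}. v $ i * v $ i) = 0"
    using assms by (simp add: scalar_prod_def)
  then have "\<forall>i\<in>{0..<n}. v $ i * v $ i = 0"
    by (subst (asm) sum_nonneg_eq_0_iff) auto
  then show "v $ i = 0\<^sub>v n $ i" using i by simp
qed (use v in simp)

lemma exists_unit_vec_orthogonal_to_rows:
  fixes V :: "real mat"
  assumes V: "V \<in> carrier_mat m n" and "m < n"
  obtains u where "u \<in> carrier_vec n" "u \<bullet> u = 1" "V *\<^sub>v u = 0\<^sub>v m"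
proof -
  \<comment> \<open>Padding \<open>V\<close> with zero rows gives a singular square matrix, which has a kernel.\<close>
  define W where "W = mat n n (\<lambda>(i,j). if i < m then V $$ (i,j) else 0)"
  have W: "W \<in> carrier_mat n n" by (simp add: W_def)
  have row_W: "i < m \<Longrightarrow> row W i = row V i" for i
    using V \<open>m < n\<close> by (auto simp: W_def)
  have "W\<^sup>T *\<^sub>v unit_vec n m = 0\<^sub>v n"
    using \<open>m < n\<close> W by (auto simp: W_def)
  moreover have "unit_vec n m \<noteq> (0\<^sub>v n :: real vec)"
    using \<open>m < n\<close> by simp
  ultimately have "det W\<^sup>T = 0"
    using W by (subst det_0_iff_vec_prod_zero[of _ n]) (auto intro!: exI[of _ "unit_vec n m"])
  then have "det W = 0" using det_transpose[OF W] by simp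
  then obtain v where v: "v \<in> carrier_vec n" "v \<noteq> 0\<^sub>v n" "W *\<^sub>v v = 0\<^sub>v n"
    using det_0_iff_vec_prod_zero[OF W] by blast
  have Vv: "V *\<^sub>v v = 0\<^sub>v m"
  proof (rule eq_vecI)
    fix i assume "i < dim_vec (0\<^sub>v m :: real vec)"
    then have i: "i < m" by simp
    have "(W *\<^sub>v v) $ i = row V i \<bullet> v" using i \<open>m < n\<close> W row_W by simp
    then show "(V *\<^sub>v v) $ i = 0\<^sub>v m $ i" using v(3) V i \<open>m < n\<close> by simp
  qed (use V in simp)
  define r where "r = v \<bullet> v"
  have "r \<ge> 0" unfolding r_def scalar_prod_def by (intro sum_nonneg) simp
  moreover have "r \<noteq> 0"
    unfolding r_def using real_scalar_prod_self_eq_0[OF v(1)] v(2) by (rule contrapos_nn[rotated])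
  ultimately have "r > 0" by simp
  define u where "u = (1 / sqrt r) \<cdot>\<^sub>v v"
  have "u \<bullet> u = (1 / sqrt r) * ((1 / sqrt r) * r)"
    using v(1) by (simp add: u_def r_def)
  also have "\<dots> = 1" using \<open>r > 0\<close> by (simp add: field_simps)
  finally have "u \<bullet> u = 1" .
  moreover have "V *\<^sub>v u = 0\<^sub>v m" using mult_mat_vec[OF V v(1)] Vv by (auto simp: u_def)
  moreover have "u \<in> carrier_vec n" using v(1) by (simp add: u_def)
  ultimately show ?thesis using that by blast
qed

text \<open>
  Rows are added one at a time. A square matrix with orthonormal rows is orthogonal because
  one-sided inverses of square matrices are two-sided.
\<close>

lemma orthonormal_rows_extend:
  fixes V :: "real mat"
  assumes "m \<le> n" and "V \<in> carrier_mat m n" and "V * V\<^sup>T = 1\<^sub>m m"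
  obtains U where "real_orthogonal_mat n U" "\<And>i. i < m \<Longrightarrow> row U i = row V i"
proof -
  from assms have "\<exists>U. real_orthogonal_mat n U \<and> (\<forall>i<m. row U i = row V i)"
  proof (induction arbitrary: V rule: inc_induct)
    case base
    then have "V\<^sup>T * V = 1\<^sub>m n" by (auto intro: mat_mult_left_right_inverse)
    with base show ?case by (auto simp: real_orthogonal_mat_def)
  next
    case (step k)
    note V = step.prems(1)
    obtain u where u: "u \<in> carrier_vec n" "u \<bullet> u = 1" "V *\<^sub>v u = 0\<^sub>v k"
      using exists_unit_vec_orthogonal_to_rows[OF V \<open>k < n\<close>] .
    define W where "W = mat\<^sub>r (Suc k) n (\<lambda>i. if i < k then row V i else u)"
    have W: "W \<in> carrier_mat (Suc k) n" by (simp add: W_def)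
    have row_W: "row W i = (if i < k then row V i else u)" if "i < Suc k" for i
      unfolding W_def by (rule row_mat_of_row_fun[OF that]) (use V u in auto)
    have VV: "row V i \<bullet> row V j = (if i = j then 1 else 0)" if "i < k" "j < k" for i j
    proof -
      have "(V * V\<^sup>T) $$ (i,j) = row V i \<bullet> row V j" using V that by simp
      then show ?thesis using step.prems(2) that by simp
    qed
    have Vu: "row V i \<bullet> u = 0" if "i < k" for i
    proof -
      have "(V *\<^sub>v u) $ i = row V i \<bullet> u" using V that by simp
      then show ?thesis using u(3) that by simp
    qed
    have uV: "u \<bullet> row V i = 0" if "i < k" for i
      using Vu[OF that] comm_scalar_prod[OF u(1), of "row V i"] V that by auto
    have "W * W\<^sup>T = 1\<^sub>m (Suc k)"
    proof (rule eq_matI)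
      fix i j assume "i < dim_row (1\<^sub>m (Suc k) :: real mat)" "j < dim_col (1\<^sub>m (Suc k) :: real mat)"
      then have ij: "i < Suc k" "j < Suc k" by auto
      then have "(W * W\<^sup>T) $$ (i,j) = row W i \<bullet> row W j" using W by simp
      then show "(W * W\<^sup>T) $$ (i,j) = 1\<^sub>m (Suc k) $$ (i,j)"
        using ij by (auto simp: row_W VV Vu uV u(2) less_Suc_eq)
    qed (use W in auto)
    from step.IH[OF W this] obtain U where U: "real_orthogonal_mat n U"
      "\<forall>i<Suc k. row U i = row W i" by blast
    then show ?case using row_W by (auto intro!: exI[of _ U])
  qed
  then show ?thesis using that by blast
qed

section \<open>Projections of congruent simplices\<close>

lemma columns_mat_dim [simp]:
  "dim_row (columns_mat d n a) = d" "dim_col (columns_mat d n a) = Suc n"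
  unfolding columns_mat_def by (simp_all only: mat_of_cols_carrier length_map length_upt)

lemma columns_mat_carrier [simp]: "columns_mat d n a \<in> carrier_mat d (Suc n)"
  by (rule carrier_matI) simp_all

lemma columns_mat_index [simp]:
  assumes "i < d" "j \<le> n"
  shows "columns_mat d n a $$ (i,j) = a j $ i"
proof -
  have "columns_mat d n a $$ (i,j) = map a [0..<n + 1] ! j $ i"
    unfolding columns_mat_def by (rule mat_of_cols_index) (use assms in simp_all)
  also have "\<dots> = a j $ i" using assms by (subst nth_map_upt) simp_all
  finally show ?thesis .
qed

lemma columns_mat_col [simp]:
  "j \<le> n \<Longrightarrow> a j \<in> carrier_vec d \<Longrightarrow> col (columns_mat d n a) j = a j"
  by (intro eq_vecI) auto

lemma projection_of_congruent_iff:
  fixes a b :: "nat \<Rightarrow> real vec"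
  assumes "m \<le> n" and a: "\<forall>j\<le>n. a j \<in> carrier_vec n"
  shows "(\<exists>c. congruent_simplices n a c \<and> (\<forall>j\<le>n. b j = vec_first (c j) m)) \<longleftrightarrow>
    (\<exists>V s. V \<in> carrier_mat m n \<and> V * V\<^sup>T = 1\<^sub>m m \<and> s \<in> carrier_vec m \<and>
      (\<forall>j\<le>n. b j = V *\<^sub>v a j + s))" (is "?L \<longleftrightarrow> ?R")
proof
  assume ?L
  then obtain c U t where U: "real_orthogonal_mat n U" and t: "t \<in> carrier_vec n"
    and c: "\<forall>j\<le>n. c j = U *\<^sub>v a j + t" and b: "\<forall>j\<le>n. b j = vec_first (c j) m"
    by (auto simp: congruent_simplices_def)
  have Uc: "U \<in> carrier_mat n n" and UU: "U * U\<^sup>T = 1\<^sub>m n"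
    using U by (auto simp: real_orthogonal_mat_def)
  define V where "V = mat m n (\<lambda>(i,j). U $$ (i,j))"
  have row_V: "i < m \<Longrightarrow> row V i = row U i" for i
    using Uc \<open>m \<le> n\<close> by (auto simp: V_def)
  have V: "V \<in> carrier_mat m n" by (simp add: V_def)
  have "V * V\<^sup>T = 1\<^sub>m m"
  proof (rule eq_matI)
    fix i j assume ij: "i < dim_row (1\<^sub>m m :: real mat)" "j < dim_col (1\<^sub>m m :: real mat)"
    then have "(V * V\<^sup>T) $$ (i,j) = (U * U\<^sup>T) $$ (i,j)"
      using V Uc \<open>m \<le> n\<close> row_V by auto
    then show "(V * V\<^sup>T) $$ (i,j) = 1\<^sub>m m $$ (i,j)"
      using UU ij \<open>m \<le> n\<close> by simp
  qed (use V in auto)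
  moreover have "b j = V *\<^sub>v a j + vec_first t m" if "j \<le> n" for j
    using that b c Uc V t \<open>m \<le> n\<close> row_V by (intro eq_vecI) (auto simp: vec_first_def)
  ultimately show ?R
    using V by (intro exI[of _ V] exI[of _ "vec_first t m"]) auto
next
  assume ?R
  then obtain V s where V: "V \<in> carrier_mat m n" "V * V\<^sup>T = 1\<^sub>m m"
    and s: "s \<in> carrier_vec m" and b: "\<forall>j\<le>n. b j = V *\<^sub>v a j + s" by blast
  obtain U where U: "real_orthogonal_mat n U" and row_U: "\<And>i. i < m \<Longrightarrow> row U i = row V i"
    using orthonormal_rows_extend[OF \<open>m \<le> n\<close> V] by blast
  have Uc: "U \<in> carrier_mat n n" using U by (auto simp: real_orthogonal_mat_def)
  define t where "t = vec n (\<lambda>i. if i < m then s $ i else 0)"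
  define c where "c = (\<lambda>j. U *\<^sub>v a j + t)"
  have "congruent_simplices n a c"
    unfolding congruent_simplices_def using U
    by (intro exI[of _ U] exI[of _ t]) (auto simp: c_def t_def)
  moreover have "b j = vec_first (c j) m" if "j \<le> n" for j
    using that b V s Uc \<open>m \<le> n\<close> row_U
    by (intro eq_vecI) (auto simp: vec_first_def c_def t_def)
  ultimately show ?L by blast
qed

section \<open>Centred non-degenerate simplices\<close>

text \<open>
  Non-degeneracy speaks of relations whose coefficients sum to zero. Since the vertices themselves
  sum to zero, subtracting the mean from all coefficients of any linear relation gives one of these.
\<close>

lemma centred_simplex_relation_constant:
  assumes nd: "nondegenerate_simplex n a"
    and centre: "finsum_vec TYPE(real) n a {..n} = 0\<^sub>v n"
    and rel: "\<And>i. i < n \<Longrightarrow> (\<Sum>j\<le>n. c j * a j $ i) = 0"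
    and "j \<le> n" "k \<le> n"
  shows "c j = c k"
proof -
  define mu where "mu = (\<Sum>j\<le>n. c j) / real (n + 1)"
  have a: "\<forall>j\<le>n. a j \<in> carrier_vec n"
    using nd by (simp add: nondegenerate_simplex_def)
  have centre': "(\<Sum>j\<le>n. a j $ i) = 0" if "i < n" for i
    using arg_cong[OF centre, of "\<lambda>v. v $ i"] that a by (subst (asm) index_finsum_vec) auto
  have "(\<Sum>j\<le>n. c j - mu) = 0"
    by (simp add: sum_subtractf mu_def)
  moreover have "finsum_vec TYPE(real) n (\<lambda>j. (c j - mu) \<cdot>\<^sub>v a j) {..n} = 0\<^sub>v n"
  proof (rule eq_vecI)
    fix i assume "i < dim_vec (0\<^sub>v n :: real vec)"
    then have i: "i < n" by simp
    have "finsum_vec TYPE(real) n (\<lambda>j. (c j - mu) \<cdot>\<^sub>v a j) {..n} $ i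
        = (\<Sum>j\<le>n. (c j - mu) * a j $ i)"
      using i a by (subst index_finsum_vec) (auto intro!: sum.cong)
    also have "\<dots> = (\<Sum>j\<le>n. c j * a j $ i) - mu * (\<Sum>j\<le>n. a j $ i)"
      by (simp add: left_diff_distrib sum_subtractf sum_distrib_left)
    finally show "finsum_vec TYPE(real) n (\<lambda>j. (c j - mu) \<cdot>\<^sub>v a j) {..n} $ i = 0\<^sub>v n $ i"
      using i rel centre' by simp
  next
    have "finsum_vec TYPE(real) n (\<lambda>j. (c j - mu) \<cdot>\<^sub>v a j) {..n} \<in> carrier_vec n"
      using a by (intro finsum_vec_closed) auto
    then show "dim_vec (finsum_vec TYPE(real) n (\<lambda>j. (c j - mu) \<cdot>\<^sub>v a j) {..n})
        = dim_vec (0\<^sub>v n :: real vec)" by simp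
  qed
  ultimately have "\<forall>j\<le>n. c j - mu = 0"
    using nd[unfolded nondegenerate_simplex_def, THEN conjunct2, rule_format,
        of "\<lambda>j. c j - mu"] by blast
  then show ?thesis using \<open>j \<le> n\<close> \<open>k \<le> n\<close> by simp
qed

text \<open>
  A vector in the kernel of \<open>A A\<^sup>T\<close> is orthogonal to all vertices. But the first \<open>n\<close> vertices
  already span the space: in a linear relation between them the last vertex has coefficient 0,
  and so all the others do.
\<close>

lemma centred_simplex_gram_det_nonzero:
  assumes nd: "nondegenerate_simplex n a"
    and centre: "finsum_vec TYPE(real) n a {..n} = 0\<^sub>v n"
  defines "A \<equiv> columns_mat n n a"
  shows "det (A * A\<^sup>T) \<noteq> 0"
proof
  have A: "A \<in> carrier_mat n (n + 1)" by (simp add: A_def)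
  have a: "\<forall>j\<le>n. a j \<in> carrier_vec n"
    using nd by (simp add: nondegenerate_simplex_def)
  assume "det (A * A\<^sup>T) = 0"
  moreover have "A * A\<^sup>T \<in> carrier_mat n n" using A by simp
  ultimately obtain x where x: "x \<in> carrier_vec n" "x \<noteq> 0\<^sub>v n" "(A * A\<^sup>T) *\<^sub>v x = 0\<^sub>v n"
    using det_0_iff_vec_prod_zero by blast
  \<comment> \<open>\<open>A\<^sup>T x\<close> vanishes because its squared norm is \<open>x \<bullet> A A\<^sup>T x\<close>.\<close>
  have "(A\<^sup>T *\<^sub>v x) \<bullet> (A\<^sup>T *\<^sub>v x) = x \<bullet> (A *\<^sub>v (A\<^sup>T *\<^sub>v x))"
    using A x by (intro transpose_vec_mult_scalar[of _ n "n + 1"]) auto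
  also have "\<dots> = 0" using x A by (simp flip: assoc_mult_mat_vec)
  finally have Ax: "A\<^sup>T *\<^sub>v x = 0\<^sub>v (n + 1)"
    using A x by (intro real_scalar_prod_self_eq_0) auto
  define M where "M = mat n n (\<lambda>(i,j). a j $ i)"
  have M: "M \<in> carrier_mat n n" by (simp add: M_def)
  have "M\<^sup>T *\<^sub>v x = 0\<^sub>v n"
  proof (rule eq_vecI)
    fix j assume "j < dim_vec (0\<^sub>v n :: real vec)"
    then have j: "j < n" by simp
    have "a j \<in> carrier_vec n" using j a by simp
    then have "col M j = col A j" using j by (auto simp: M_def A_def)
    then have "(M\<^sup>T *\<^sub>v x) $ j = (A\<^sup>T *\<^sub>v x) $ j" using j M A by simp
    then show "(M\<^sup>T *\<^sub>v x) $ j = 0\<^sub>v n $ j" using Ax j by simp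
  qed (use M in simp)
  then have "det M\<^sup>T = 0" using det_0_iff_vec_prod_zero[of "M\<^sup>T" n] M x by auto
  then have "det M = 0" using det_transpose[OF M] by simp
  then obtain y where y: "y \<in> carrier_vec n" "y \<noteq> 0\<^sub>v n" "M *\<^sub>v y = 0\<^sub>v n"
    using det_0_iff_vec_prod_zero[OF M] by blast
  define c where "c j = (if j < n then y $ j else 0)" for j
  have "(\<Sum>j\<le>n. c j * a j $ i) = 0" if "i < n" for i
  proof -
    have "(\<Sum>j\<le>n. c j * a j $ i) = (\<Sum>j\<in>{0..<n}. a j $ i * y $ j)"
      by (intro sum.mono_neutral_cong_right) (auto simp: c_def)
    also have "\<dots> = (M *\<^sub>v y) $ i" using that y(1) by (simp add: M_def scalar_prod_def)
    finally show ?thesis using y(3) that by simp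
  qed
  then have "c j = c n" if "j < n" for j
    using centred_simplex_relation_constant[OF nd centre, of c j n] that by simp
  then have "y = 0\<^sub>v n" using y(1) by (intro eq_vecI) (auto simp: c_def)
  with y(2) show False by contradiction
qed

lemma centred_simplex_gram_inverse:
  assumes nd: "nondegenerate_simplex n a"
    and centre: "finsum_vec TYPE(real) n a {..n} = 0\<^sub>v n"
  defines "A \<equiv> columns_mat n n a"
  obtains T where "T \<in> carrier_mat n n" "A * A\<^sup>T * T = 1\<^sub>m n" "T * (A * A\<^sup>T) = 1\<^sub>m n"
    "T\<^sup>T = T" "Q_mat A = A\<^sup>T * (T * T) * A"
proof -
  have A: "A \<in> carrier_mat n (n + 1)" by (simp add: A_def)
  have S: "A * A\<^sup>T \<in> carrier_mat n n" using A by simp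
  have "A * A\<^sup>T \<in> Units (ring_mat TYPE(real) n ())"
    using det_non_zero_imp_unit[OF S] centred_simplex_gram_det_nonzero[OF nd centre]
    unfolding A_def .
  then have "mat_inverse (A * A\<^sup>T) \<noteq> None"
    using mat_inverse(1)[OF S, where b = "()"] by argo
  then obtain T where T_inv: "mat_inverse (A * A\<^sup>T) = Some T" by blast
  have T: "T \<in> carrier_mat n n" "A * A\<^sup>T * T = 1\<^sub>m n" "T * (A * A\<^sup>T) = 1\<^sub>m n"
    using mat_inverse(2)[OF S T_inv] by blast+
  have "(A * A\<^sup>T)\<^sup>T = A * A\<^sup>T" using A by (simp add: transpose_mult[of A n "n + 1" _ n])
  then have "A * A\<^sup>T * T\<^sup>T = 1\<^sub>m n"
    using arg_cong[OF T(3), of transpose_mat] transpose_mult[OF T(1) S] by simp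
  then have "T = T * (A * A\<^sup>T * T\<^sup>T)" using T(1) by simp
  also have "\<dots> = T\<^sup>T"
    using T S by (subst assoc_mult_mat[symmetric, of _ n n _ n _ n]) auto
  finally have sym: "T\<^sup>T = T" ..
  have "the (mat_inverse (A * A\<^sup>T)) ^\<^sub>m 2 = T * T"
    using T_inv T(1) by (simp add: numeral_2_eq_2)
  then show ?thesis using that[OF T sym] by (simp add: Q_mat_def)
qed

section \<open>The criterion\<close>

lemma assoc_mult_mat_dim:
  fixes A B C :: "real mat"
  assumes "dim_col A = dim_row B" and "dim_col B = dim_row C"
  shows "A * B * C = A * (B * C)"
  using assms by (intro assoc_mult_mat[of _ "dim_row A" "dim_col A" _ "dim_col B" _ "dim_col C"]) auto

theorem theorem3:
  fixes m n :: nat and a b :: "nat \<Rightarrow> real vec"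
  assumes "1 \<le> m" and "m \<le> n"
    and "nondegenerate_simplex n a"
    and "finsum_vec TYPE(real) n a {..n} = 0\<^sub>v n"
    and "\<forall>j\<le>n. b j \<in> carrier_vec m"
  shows "(\<exists>c. congruent_simplices n a c \<and> (\<forall>j\<le>n. b j = vec_first (c j) m)) \<longleftrightarrow>
    columns_mat m n b * Q_mat (columns_mat n n a) * (columns_mat m n b)\<^sup>T = 1\<^sub>m m"
proof -
  note nd = assms(3) and centre = assms(4) and b = assms(5)
  have a: "\<forall>j\<le>n. a j \<in> carrier_vec n"
    using nd by (simp add: nondegenerate_simplex_def)
  define A where "A = columns_mat n n a"
  define B where "B = columns_mat m n b"
  have A: "A \<in> carrier_mat n (n + 1)" and B: "B \<in> carrier_mat m (n + 1)"
    by (simp_all add: A_def B_def)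
  obtain T where T: "T \<in> carrier_mat n n" "A * A\<^sup>T * T = 1\<^sub>m n" "T * (A * A\<^sup>T) = 1\<^sub>m n"
    "T\<^sup>T = T" "Q_mat A = A\<^sup>T * (T * T) * A"
    using centred_simplex_gram_inverse[OF nd centre] unfolding A_def by blast
  define V where "V = B * A\<^sup>T * T"
  have V: "V \<in> carrier_mat m n" using A B T by (simp add: V_def)
  have "V\<^sup>T = T\<^sup>T * (B * A\<^sup>T)\<^sup>T"
    unfolding V_def using A B T(1) by (intro transpose_mult[of _ m n _ n]) auto
  also have "(B * A\<^sup>T)\<^sup>T = A * B\<^sup>T"
    using A B by (simp add: transpose_mult[of B m "n + 1" _ n])
  finally have "V * V\<^sup>T = B * A\<^sup>T * T * (T * (A * B\<^sup>T))"
    by (simp only: V_def T(4))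
  also have "\<dots> = B * Q_mat A * B\<^sup>T"
    using A B T(1) by (simp add: T(5) assoc_mult_mat_dim)
  finally have VV: "V * V\<^sup>T = B * Q_mat A * B\<^sup>T" .

  \<comment> \<open>A linear part that maps the \<open>a\<^sub>j\<close> to the \<open>b\<^sub>j\<close> up to a translation is determined by \<open>A\<close> and \<open>B\<close>.\<close>
  have unique: "W = V" if W: "W \<in> carrier_mat m n" and s: "s \<in> carrier_vec m"
    and bW: "\<forall>j\<le>n. b j = W *\<^sub>v a j + s" for W s
  proof -
    define K where "K = mat m (n + 1) (\<lambda>(i,j). s $ i)"
    have K: "K \<in> carrier_mat m (n + 1)" by (simp add: K_def)
    have "B = W * A + K"
      using W s A bW a b by (intro eq_matI) (auto simp: B_def A_def K_def)
    moreover have "K * A\<^sup>T = 0\<^sub>m m n"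
    proof (rule eq_matI)
      fix i k assume "i < dim_row (0\<^sub>m m n :: real mat)" "k < dim_col (0\<^sub>m m n :: real mat)"
      then have ik: "i < m" "k < n" by auto
      then have "(K * A\<^sup>T) $$ (i,k) = (\<Sum>j\<in>{0..<n+1}. s $ i * a j $ k)"
        by (auto simp: K_def A_def scalar_prod_def intro!: sum.cong)
      also have "\<dots> = s $ i * (\<Sum>j\<le>n. a j $ k)"
        unfolding sum_distrib_left by (intro sum.cong) auto
      also have "(\<Sum>j\<le>n. a j $ k) = 0"
        using arg_cong[OF centre, of "\<lambda>v. v $ k"] ik a by (subst (asm) index_finsum_vec) auto
      finally show "(K * A\<^sup>T) $$ (i,k) = 0\<^sub>m m n $$ (i,k)" using ik by simp
    qed (use K A in auto)
    ultimately have "B * A\<^sup>T = W * (A * A\<^sup>T)"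
      using A W K by (simp add: add_mult_distrib_mat[of _ m "n + 1"] assoc_mult_mat_dim)
    then have "V = W * (A * A\<^sup>T * T)"
      using A W T(1) by (simp add: V_def assoc_mult_mat_dim)
    then show ?thesis using T(2) W by simp
  qed

  \<comment> \<open>Conversely, \<open>V\<close> maps the \<open>a\<^sub>j\<close> to the \<open>b\<^sub>j\<close> up to a translation for every \<open>B\<close>,
    whether or not its rows are orthonormal.\<close>
  have exists: "\<exists>s\<in>carrier_vec m. \<forall>j\<le>n. b j = V *\<^sub>v a j + s"
  proof -
    \<comment> \<open>\<open>R\<close> is the orthogonal projection onto the kernel of \<open>A\<close>.\<close>
    define R where "R = 1\<^sub>m (n + 1) - A\<^sup>T * T * A"
    have R: "R \<in> carrier_mat (n + 1) (n + 1)"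
      unfolding R_def using A T(1) by (intro minus_carrier_mat) auto
    have "A * (A\<^sup>T * T * A) = A * A\<^sup>T * T * A"
      using A T(1) by (simp add: assoc_mult_mat_dim)
    then have AR: "A * R = 0\<^sub>m n (n + 1)"
      using A T(1,2) by (simp add: R_def mult_minus_distrib_mat[of _ n "n + 1" _ "n + 1"])
    have "(A\<^sup>T * T * A)\<^sup>T = A\<^sup>T * (A\<^sup>T * T)\<^sup>T"
      using A T(1) by (intro transpose_mult[of _ "n + 1" n _ "n + 1"]) auto
    also have "(A\<^sup>T * T)\<^sup>T = T * A"
      using A T(1,4) by (simp add: transpose_mult[of _ "n + 1" n _ n])
    also have "A\<^sup>T * (T * A) = A\<^sup>T * T * A"
      using A T(1) by (simp add: assoc_mult_mat_dim)
    finally have "(A\<^sup>T * T * A)\<^sup>T = A\<^sup>T * T * A" .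
    then have R_sym: "R\<^sup>T = R"
      unfolding R_def using A T(1) by (subst transpose_minus[of _ "n + 1" "n + 1"]) auto
    have R_col: "R $$ (i,j) = R $$ (0,j)" if "i \<le> n" "j \<le> n" for i j
    proof (rule centred_simplex_relation_constant[OF nd centre])
      fix k assume k: "k < n"
      have "(\<Sum>i\<le>n. R $$ (i,j) * a i $ k) = (\<Sum>i\<in>{0..<n+1}. A $$ (k,i) * R $$ (i,j))"
        using k by (intro sum.cong) (auto simp: A_def)
      also have "\<dots> = (A * R) $$ (k,j)"
        using A R k that by (simp add: scalar_prod_def)
      finally show "(\<Sum>i\<le>n. R $$ (i,j) * a i $ k) = 0"
        using AR k that by simp
    qed (use that in auto)
    have R_row: "R $$ (i,j) = R $$ (i,0)" if "i \<le> n" "j \<le> n" for i j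
    proof -
      have sym: "R $$ (p,q) = R $$ (q,p)" if "p \<le> n" "q \<le> n" for p q
        using R that arg_cong[OF R_sym, of "\<lambda>M. M $$ (p,q)"] by simp
      show ?thesis using R_col[of j i] sym that by simp
    qed
    have "V * A = B * (A\<^sup>T * T * A)"
      using A B T(1) by (simp add: V_def assoc_mult_mat_dim)
    moreover have "B * R = B * 1\<^sub>m (n + 1) - B * (A\<^sup>T * T * A)"
      unfolding R_def using A B T(1) by (intro mult_minus_distrib_mat[of _ m "n + 1" _ "n + 1"]) auto
    ultimately have "B * R = B - V * A" using B by simp
    then have dec: "V * A + B * R = B" using A B V by (intro eq_matI) auto
    define s where "s = col (B * R) 0"
    have s: "s \<in> carrier_vec m" unfolding s_def by (rule carrier_vecI) (use B in simp)
    have "b j = V *\<^sub>v a j + s" if j: "j \<le> n" for j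
    proof -
      have "col R j = col R 0"
      proof (rule eq_vecI)
        fix i assume "i < dim_vec (col R 0)"
        then have "i \<le> n" using R by simp
        then show "col R j $ i = col R 0 $ i" using R_row[of i j] R j by simp
      qed simp
      then have "col (B * R) j = s"
        using B R j unfolding s_def by (intro eq_vecI) auto
      moreover have "col (V * A) j = V *\<^sub>v a j"
        using V A a j by (subst col_mult2[of _ m n _ "n + 1"]) (auto simp: A_def)
      moreover have "col (V * A + B * R) j = col (V * A) j + col (B * R) j"
        using V A B R j by (intro eq_vecI) auto
      moreover have "b j = col (V * A + B * R) j" using b j unfolding dec by (simp add: B_def)
      ultimately show ?thesis by simp
    qed
    with s show ?thesis by blast
  qed
  show ?thesis
    unfolding projection_of_congruent_iff[OF \<open>m \<le> n\<close> a]
    using unique exists V VV unfolding A_def B_def by metis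
qed

end
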